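(* Let $G$ be a graph, $S\subseteq V(G)$ with $|S|=s$, and $\ell\leq s$ a natural number. If for all $1\leq k\leq s$ $$\sum_{W\in\binom{S}{k}}|\mathrm{Obs}(G;W)|=\sum_{i=1}^{\ell}\alpha_{s,\ell}(k,i)\sum_{W\in\binom{S}{i}}|\mathrm{Obs}(G;W)|,$$ then $\mathcal{E}(G;S,q)$ has degree at most $\ell$.
   Context: Graphs are finite and simple; $N[X]$ is the closed neighborhood of $X$. Power domination process on a graph $H$ from $T\subseteq V(H)$: set $B:=N[T]$; then, while some $x\in B$ has exactly one vertex $y$ of $N[x]$ outside $B$, add $y$ to $B$. The final set is $\mathrm{Obs}(H;T)$ (with $\mathrm{Obs}(H;\emptyset)=\emptyset$). For $S\subseteq V(H)$, $\mathcal{E}(H;S,q)=\sum_{W\subseteq S}|\mathrm{Obs}(H;W)|\,q^{|S\setminus W|}(1-q)^{|W|}$. $\binom{S}{k}$ is the set of $k$-element subsets of $S$. The numbers $\alpha_{s,\ell}(k,i)$ are defined recursively by $\alpha_{s,\ell}(k,i):=\binom{s-i}{k-i}-\sum_{j=i+1}^{\ell}\alpha_{s,\ell}(k,j)\binom{s-i}{j-i}$ (empty sum $=0$; binomial coefficients with lower index negative or exceeding the upper index are $0$). *)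

theory Defs
  imports "Graph_Theory.Pair_Digraph" "HOL-Computational_Algebra.Polynomial"
begin

text \<open>
  A finite simple graph is a \<open>pair_graph\<close>: a finite vertex set with a symmetric, irreflexive
  arc relation, an edge \<open>uv\<close> being represented by the two arcs \<open>(u, v)\<close> and \<open>(v, u)\<close>.
\<close>

definition closed_nbhd :: "'a pair_pre_digraph \<Rightarrow> 'a set \<Rightarrow> 'a set" where
  "closed_nbhd G X = X \<union> {v. \<exists>u\<in>X. (u, v) \<in> parcs G}"

definition obs_step :: "'a pair_pre_digraph \<Rightarrow> 'a set \<Rightarrow> 'a set \<Rightarrow> bool" where
  "obs_step G B B' \<longleftrightarrow> (\<exists>x\<in>B. \<exists>y. closed_nbhd G {x} - B = {y} \<and> B' = insert y B)"

definition obs_final :: "'a pair_pre_digraph \<Rightarrow> 'a set \<Rightarrow> 'a set \<Rightarrow> bool" where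
  "obs_final G T B \<longleftrightarrow> (obs_step G)\<^sup>*\<^sup>* (closed_nbhd G T) B \<and> (\<nexists>B'. obs_step G B B')"

text \<open>
  The order of the steps is not prescribed. Lemma \<open>obs_final_ex1\<close> below shows that for
  \<open>T \<subseteq> pverts G\<close> the process terminates and that its final set does not depend on that order.
\<close>

definition Obs :: "'a pair_pre_digraph \<Rightarrow> 'a set \<Rightarrow> 'a set" where
  "Obs G T = (THE B. obs_final G T B)"

lemma obs_step_subset_final:
  assumes "(obs_step G)\<^sup>*\<^sup>* A B" "A \<subseteq> C" "\<nexists>C'. obs_step G C C'"
  shows "B \<subseteq> C"
  using assms(1)
proof induction
  case base
  show ?case by fact
next
  case (step B B')
  then obtain x y where xy: "x \<in> B" "closed_nbhd G {x} - B = {y}" "B' = insert y B"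
    by (auto simp: obs_step_def)
  have "y \<in> C"
  proof (rule ccontr)
    assume "y \<notin> C"
    then have "closed_nbhd G {x} - C = {y}" using xy(2) step.IH by blast
    then have "obs_step G C (insert y C)"
      using xy(1) step.IH unfolding obs_step_def by blast
    with assms(3) show False by blast
  qed
  then show ?case using xy(3) step.IH by simp
qed

lemma (in pair_graph) closed_nbhd_subset: "X \<subseteq> pverts G \<Longrightarrow> closed_nbhd G X \<subseteq> pverts G"
  by (auto simp: closed_nbhd_def dest: in_arcsD2)

lemma (in pair_graph) obs_terminates:
  "A \<subseteq> pverts G \<Longrightarrow> \<exists>B. (obs_step G)\<^sup>*\<^sup>* A B \<and> (\<nexists>B'. obs_step G B B')"
proof (induction "card (pverts G - A)" arbitrary: A rule: less_induct)
  case less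
  show ?case
  proof (cases "\<exists>A'. obs_step G A A'")
    case False
    then show ?thesis by blast
  next
    case True
    then obtain x y where xy: "x \<in> A" "closed_nbhd G {x} - A = {y}"
      and st: "obs_step G A (insert y A)"
      by (auto simp: obs_step_def)
    have "y \<in> pverts G" using closed_nbhd_subset[of "{x}"] xy less.prems by blast
    moreover have "y \<notin> A" using xy(2) by blast
    ultimately have "pverts G - insert y A \<subset> pverts G - A" "insert y A \<subseteq> pverts G"
      using less.prems by blast+
    moreover have "finite (pverts G - A)" using pair_finite_verts by simp
    ultimately obtain B where "(obs_step G)\<^sup>*\<^sup>* (insert y A) B" "\<nexists>B'. obs_step G B B'"
      using less.hyps[of "insert y A"] psubset_card_mono by blast
    with st show ?thesis by (meson converse_rtranclp_into_rtranclp)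
  qed
qed

lemma (in pair_graph) obs_final_ex1:
  assumes "T \<subseteq> pverts G"
  shows "\<exists>!B. obs_final G T B"
proof -
  obtain B where B: "obs_final G T B"
    using obs_terminates[OF closed_nbhd_subset[OF assms]] by (auto simp: obs_final_def)
  moreover have "C = B" if "obs_final G T C" for C
  proof -
    have "closed_nbhd G T \<subseteq> D" if "(obs_step G)\<^sup>*\<^sup>* (closed_nbhd G T) D" for D
      using that by induction (auto simp: obs_step_def)
    then show ?thesis
      using B that obs_step_subset_final unfolding obs_final_def
      by (metis subset_antisym)
  qed
  ultimately show ?thesis by blast
qed

lemma (in pair_graph) obs_final_Obs: "T \<subseteq> pverts G \<Longrightarrow> obs_final G T (Obs G T)"
  unfolding Obs_def by (rule theI'[OF obs_final_ex1])

lemma Obs_empty: "Obs G {} = {}"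
proof -
  have N: "closed_nbhd G {} = {}" and no: "\<not> obs_step G {} B" for B
    by (simp_all add: closed_nbhd_def obs_step_def)
  have "obs_final G {} B \<longleftrightarrow> B = {}" for B
    unfolding obs_final_def N using no by (auto elim: converse_rtranclpE)
  then show ?thesis by (simp add: Obs_def)
qed

text \<open>
  The expected value as a polynomial in the indeterminate \<open>q = [:0, 1:]\<close>, so that
  \<open>1 - q = [:1, -1:]\<close>.
\<close>

definition expected_obs :: "'a pair_pre_digraph \<Rightarrow> 'a set \<Rightarrow> real poly" where
  "expected_obs G S =
     (\<Sum>W\<in>Pow S. of_nat (card (Obs G W)) * [:0, 1:] ^ card (S - W) * [:1, -1:] ^ card W)"

lemma poly_expected_obs:
  "poly (expected_obs G S) q =
     (\<Sum>W\<in>Pow S. real (card (Obs G W)) * q ^ card (S - W) * (1 - q) ^ card W)"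
  by (simp add: expected_obs_def poly_sum)

text \<open>
  Arguments are integers: with truncated natural number subtraction, \<open>(s - i) choose (k - i)\<close>
  would be \<open>1\<close> rather than \<open>0\<close> for \<open>k < i\<close>.
\<close>

definition binom :: "int \<Rightarrow> int \<Rightarrow> int" where
  "binom n k = (if 0 \<le> k \<and> k \<le> n then int (nat n choose nat k) else 0)"

function alpha :: "nat \<Rightarrow> nat \<Rightarrow> nat \<Rightarrow> nat \<Rightarrow> int" where
  "alpha s l k i = binom (int s - int i) (int k - int i)
     - (\<Sum>j = i + 1..l. alpha s l k j * binom (int s - int i) (int j - int i))"
  by auto
termination by (relation "measure (\<lambda>(s, l, k, i). Suc l - i)") auto

declare alpha.simps [simp del]

end

theory Submission
  imports Defs
begin

text \<open>
  Let \<open>a\<^sub>k\<close> be the sum of \<open>card (Obs G W)\<close> over the \<open>k\<close>-subsets \<open>W\<close> of \<open>S\<close>. Then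
  \<open>expected_obs G S\<close> is the sum of \<open>a\<^sub>k q\<^sup>s\<^sup>-\<^sup>k (1 - q)\<^sup>k\<close>, and substituting the hypothesis
  writes it as a combination of the polynomials
  \<open>P\<^sub>i = \<Sum>k\<le>s. alpha s l k i * q\<^sup>s\<^sup>-\<^sup>k * (1 - q)\<^sup>k\<close> with \<open>1 \<le> i \<le> l\<close>.
  By the binomial theorem, the recursion for \<open>alpha\<close> becomes
  \<open>P\<^sub>i = (1 - q)\<^sup>i - \<Sum>j = i + 1..l. binom (s - i) (j - i) * P\<^sub>j\<close>, the factor
  \<open>(q + (1 - q))\<^sup>s\<^sup>-\<^sup>i\<close> being \<open>1\<close>. Descending induction on \<open>i\<close> bounds the degree of \<open>P\<^sub>i\<close>
  by \<open>l\<close>.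
\<close>

text \<open>Every term of the recursion vanishes, as its indices \<open>j > i\<close> also exceed
  \<open>k\<close>. This settles \<open>k = 0\<close> in the final theorem.\<close>

lemma alpha_eq_0: "k < i \<Longrightarrow> alpha s l k i = 0"
proof (induction s l k i rule: alpha.induct)
  case (1 s l k i)
  then show ?case by (subst alpha.simps) (simp add: binom_def)
qed

lemma binom_diff_nat:
  "i \<le> k \<Longrightarrow> k \<le> s \<Longrightarrow> binom (int s - int i) (int k - int i) = int ((s - i) choose (k - i))"
  by (simp add: binom_def flip: of_nat_diff)

text \<open>The binomial theorem with index \<open>k = m + i\<close>; terms with
  \<open>k < i\<close> are zero by the convention in \<open>binom\<close>.\<close>

lemma shifted_binomial:
  fixes x y :: "'a::comm_ring_1"
  assumes "i \<le> s"
  shows "(\<Sum>k\<le>s. of_int (binom (int s - int i) (int k - int i)) * x ^ (s - k) * y ^ k)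
    = y ^ i * (x + y) ^ (s - i)"
proof -
  let ?f = "\<lambda>k. of_int (binom (int s - int i) (int k - int i)) * x ^ (s - k) * y ^ k"
  have "sum ?f {..s} = sum ?f {0 + i..(s - i) + i}"
    using assms by (intro sum.mono_neutral_right) (auto simp: binom_def)
  also have "\<dots> = (\<Sum>m = 0..s - i. ?f (m + i))"
    by (rule sum.shift_bounds_cl_nat_ivl)
  also have "\<dots> = (\<Sum>m\<le>s - i. y ^ i * (of_nat ((s - i) choose m) * y ^ m * x ^ (s - i - m)))"
  proof (rule sum.cong)
    fix m assume "m \<in> {..s - i}"
    then have "m + i \<le> s" using assms by auto
    then show "?f (m + i) = y ^ i * (of_nat ((s - i) choose m) * y ^ m * x ^ (s - i - m))"
      using binom_diff_nat[of i "m + i" s] by (simp add: power_add ac_simps)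
  qed auto
  also have "\<dots> = y ^ i * (y + x) ^ (s - i)"
    by (simp add: binomial_ring sum_distrib_left)
  finally show ?thesis by (simp add: add.commute)
qed

lemma sum_alpha_rec:
  fixes x y :: "'a::comm_ring_1"
  assumes "i \<le> s" "x + y = 1"
  shows "(\<Sum>k\<le>s. of_int (alpha s l k i) * x ^ (s - k) * y ^ k) = y ^ i
    - (\<Sum>j = i + 1..l. of_int (binom (int s - int i) (int j - int i)) *
        (\<Sum>k\<le>s. of_int (alpha s l k j) * x ^ (s - k) * y ^ k))"
proof -
  let ?b = "\<lambda>j. of_int (binom (int s - int i) (int j - int i)) :: 'a"
  have "(\<Sum>k\<le>s. of_int (alpha s l k i) * x ^ (s - k) * y ^ k) =
    (\<Sum>k\<le>s. ?b k * x ^ (s - k) * y ^ k)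
     - (\<Sum>k\<le>s. \<Sum>j = i + 1..l. ?b j * (of_int (alpha s l k j) * x ^ (s - k) * y ^ k))"
    \<comment> \<open>Fixing \<open>i\<close> keeps the recursive calls at \<open>j\<close>
      folded.\<close>
    unfolding alpha.simps[of s l _ i] of_int_diff of_int_sum of_int_mult
      left_diff_distrib sum_subtractf sum_distrib_right
    by (simp add: ac_simps)
  also have "(\<Sum>k\<le>s. ?b k * x ^ (s - k) * y ^ k) = y ^ i"
    using assms by (simp add: shifted_binomial)
  finally show ?thesis
    by (subst (asm) sum.swap) (simp add: sum_distrib_left)
qed

lemma degree_of_int_mult_le:
  fixes p :: "'a::comm_ring_1 poly"
  shows "degree p \<le> n \<Longrightarrow> degree (of_int c * p) \<le> n"
  by (metis degree_smult_le of_int_poly order_trans mult_pCons_left mult_zero_left pCons_0_0 add_0_right)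

lemma degree_sum_alpha_le:
  assumes "i \<le> l" "l \<le> s"
  shows "degree (\<Sum>k\<le>s. of_int (alpha s l k i) * [:0, 1:] ^ (s - k) * [:1, - 1 :: real:] ^ k) \<le> l"
  using assms(1)
proof (induction "l - i" arbitrary: i rule: less_induct)
  case less
  have "degree ([:1, - 1 :: real:] ^ i) \<le> l"
    using degree_power_le[of "[:1, - 1 :: real:]" i] less.prems by simp
  moreover have "degree (\<Sum>k\<le>s. of_int (alpha s l k j) * [:0, 1:] ^ (s - k) * [:1, - 1 :: real:] ^ k) \<le> l"
    if "j \<in> {i + 1..l}" for j
    using less.hyps[of j] that by auto
  moreover have "i \<le> s" "[:0, 1:] + [:1, - 1 :: real:] = 1"
    using less.prems assms(2) by (simp_all add: one_pCons)
  \<comment> \<open>The side condition \<open>i \<le> s\<close> is known only for the outer index,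
    so the inner sums stay intact for the induction hypothesis.\<close>
  ultimately show ?case
    by (simp only: sum_alpha_rec)
      (rule degree_diff_le, assumption, rule degree_sum_le, simp,
        rule degree_of_int_mult_le, blast)
qed

lemma expected_obs_by_card:
  assumes "finite S"
  shows "expected_obs G S = (\<Sum>k\<le>card S.
    of_nat (\<Sum>W | W \<subseteq> S \<and> card W = k. card (Obs G W)) * [:0, 1:] ^ (card S - k) * [:1, -1:] ^ k)"
proof -
  have "expected_obs G S = (\<Sum>k\<le>card S. \<Sum>W | W \<in> Pow S \<and> card W = k.
      of_nat (card (Obs G W)) * [:0, 1:] ^ card (S - W) * [:1, -1:] ^ card W)"
    unfolding expected_obs_def
    by (rule sum.group[symmetric]) (use assms in \<open>auto intro: card_mono\<close>)
  also have "\<dots> = (\<Sum>k\<le>card S. \<Sum>W | W \<subseteq> S \<and> card W = k.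
      of_nat (card (Obs G W)) * [:0, 1:] ^ (card S - k) * [:1, -1:] ^ k)"
    by (intro sum.cong) (auto simp: card_Diff_subset finite_subset[OF _ assms])
  finally show ?thesis by (simp only: of_nat_sum sum_distrib_right)
qed

theorem theorem3p6:
  fixes G :: "'a pair_pre_digraph" and S :: "'a set" and s l :: nat
  assumes "pair_graph G"
    and "S \<subseteq> pverts G"
    and "card S = s"
    and "l \<le> s"
    and "\<And>k. 1 \<le> k \<Longrightarrow> k \<le> s \<Longrightarrow>
      int (\<Sum>W | W \<subseteq> S \<and> card W = k. card (Obs G W)) =
      (\<Sum>i = 1..l. alpha s l k i * int (\<Sum>W | W \<subseteq> S \<and> card W = i. card (Obs G W)))"
  shows "degree (expected_obs G S) \<le> l"
proof -
  interpret pair_graph G by fact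
  have fin: "finite S" using assms(2) pair_finite_verts finite_subset by blast
  define a where "a k = (\<Sum>W | W \<subseteq> S \<and> card W = k. card (Obs G W))" for k
  \<comment> \<open>The hypothesis starts at \<open>k = 1\<close>; at \<open>k = 0\<close> both
    sides are zero.\<close>
  have "{W. W \<subseteq> S \<and> card W = 0} = {{}}"
    using fin by (auto dest: finite_subset)
  then have "a 0 = 0" by (simp add: a_def Obs_empty)
  then have a: "int (a k) = (\<Sum>i = 1..l. alpha s l k i * int (a i))" if "k \<le> s" for k
    using assms(5)[of k] that by (cases "k = 0") (simp_all add: a_def[symmetric] alpha_eq_0)
  let ?m = "\<lambda>k. [:0, 1:] ^ (s - k) * [:1, - 1 :: real:] ^ k"
  have "expected_obs G S = (\<Sum>k\<le>s. of_int (int (a k)) * ?m k)"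
    using expected_obs_by_card[OF fin] by (simp add: assms(3) mult.assoc a_def)
  also have "\<dots> = (\<Sum>k\<le>s. \<Sum>i = 1..l. of_int (int (a i)) * (of_int (alpha s l k i) * ?m k))"
    \<comment> \<open>Keeping \<open>of_int (int (a k))\<close> unsimplified lets the integer
      identity \<open>a\<close> rewrite it.\<close>
    by (rule sum.cong) (simp_all add: a sum_distrib_left ac_simps del: of_int_of_nat_eq)
  also have "\<dots> = (\<Sum>i = 1..l. of_int (int (a i)) * (\<Sum>k\<le>s. of_int (alpha s l k i) * ?m k))"
    by (subst sum.swap) (simp only: sum_distrib_left)
  also have "degree \<dots> \<le> l"
    using degree_sum_alpha_le[OF _ assms(4)]
    by (intro degree_sum_le[OF finite_atLeastAtMost] degree_of_int_mult_le) (simp add: mult.assoc)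
  finally show ?thesis .
qed

end
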